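(* Let $H=(V_H,E_H,w_H)$ be a connected hypergraph, let $\Upsilon_H$ be its rank, and let $\nu_2(H)$ be the second smallest eigenvalue of its normalized Laplacian $\mathcal{L}_H$. Then $$\frac{\nu_2(H)}{\Upsilon_H}\ \le\ \phi_h(H)\ \le\ \sqrt{2\,\nu_2(H)},$$ where $\phi_h(H)$ is the conductance of $H$.
   Context: A hypergraph $H=(V_H,E_H,w_H)$ consists of a nonempty finite vertex set $V_H$ with $n$ elements, a finite set $E_H\subseteq 2^{V_H}$ of hyperedges, each of size at least $2$, and a weight function $w_H:E_H\to[0,\infty)$. Hyperedges may have different sizes. The degree of $u$ is $d_H(u)=\sum_{e\in E_H:\,u\in e}w_H(e)$; all degrees are assumed positive. The rank $\Upsilon_H$ is the maximum size of a hyperedge. $H$ is connected if for all $u,v\in V_H$ there are hyperedges $e_1,\dots,e_m$ with $u\in e_1$, $v\in e_m$ and $e_i\cap e_{i+1}\neq\emptyset$ for $1\le i<m$. For $S\subseteq V_H$ let $\mathrm{vol}_H(S)=\sum_{v\in S}d_H(v)$ and $\partial_h(S)=\{e\in E_H: e\cap S\ne\emptyset,\ e\cap(V_H\setminus S)\neq\emptyset\}$. The conductance of $S$ with $\emptyset\subsetneq S\subsetneq V_H$ is $$\phi_h(S)=\frac{\sum_{e\in\partial_h(S)}w_H(e)}{\min(\mathrm{vol}_H(S),\mathrm{vol}_H(V_H\setminus S))},$$ and $\phi_h(H)=\min_{\emptyset\subsetneq S\subsetneq V_H}\phi_h(S)$. The adjacency matrix is $A_H[u,v]=\sum_{e\in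 E_H:\{u,v\}\subseteq e}\frac{w_H(e)}{|e|-1}$ for $u\ne v$ and $A_H[u,u]=0$. $D_H$ is the diagonal matrix of degrees, $L_H=D_H-A_H$ is the Laplacian, and $\mathcal{L}_H=D_H^{-1/2}L_HD_H^{-1/2}$ is the normalized Laplacian, with eigenvalues $\nu_1(H)\le\nu_2(H)\le\dots\le\nu_n(H)$ counted with multiplicity. *)

theory Defs
  imports "HOL-Analysis.Analysis" "HOL-Computational_Algebra.Polynomial"
begin

text \<open>The vertex set is \<open>UNIV\<close> of a finite type \<open>'v\<close>, so \<open>n = CARD('v)\<close>.\<close>

record 'v hypergraph =
  hedges :: "'v set set"
  hweight :: "'v set \<Rightarrow> real"

definition degree_h :: "'v::finite hypergraph \<Rightarrow> 'v \<Rightarrow> real" where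
  "degree_h H u = (\<Sum>e\<in>{e \<in> hedges H. u \<in> e}. hweight H e)"

text \<open>Positivity of all degrees is a standing assumption and is included here.\<close>

definition is_hypergraph :: "'v::finite hypergraph \<Rightarrow> bool" where
  "is_hypergraph H \<longleftrightarrow>
     (\<forall>e\<in>hedges H. card e \<ge> 2) \<and>
     (\<forall>e\<in>hedges H. hweight H e \<ge> 0) \<and>
     (\<forall>u. degree_h H u > 0)"

definition rank_h :: "'v::finite hypergraph \<Rightarrow> nat" where
  "rank_h H = Max (card ` hedges H)"

definition connected_h :: "'v::finite hypergraph \<Rightarrow> bool" where
  "connected_h H \<longleftrightarrow>
     (\<forall>u v. \<exists>es. es \<noteq> [] \<and> set es \<subseteq> hedges H \<and> u \<in> hd es \<and> v \<in> last es \<and>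
        (\<forall>i. Suc i < length es \<longrightarrow> es ! i \<inter> es ! Suc i \<noteq> {}))"

definition vol_h :: "'v::finite hypergraph \<Rightarrow> 'v set \<Rightarrow> real" where
  "vol_h H S = (\<Sum>v\<in>S. degree_h H v)"

definition boundary_h :: "'v::finite hypergraph \<Rightarrow> 'v set \<Rightarrow> 'v set set" where
  "boundary_h H S = {e \<in> hedges H. e \<inter> S \<noteq> {} \<and> e \<inter> (UNIV - S) \<noteq> {}}"

definition set_conductance :: "'v::finite hypergraph \<Rightarrow> 'v set \<Rightarrow> real" where
  "set_conductance H S =
     (\<Sum>e\<in>boundary_h H S. hweight H e) / min (vol_h H S) (vol_h H (UNIV - S))"

text \<open>The minimum ranges over a set that is nonempty, since positive degrees
  and edges of size at least 2 force at least two vertices.\<close>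

definition conductance :: "'v::finite hypergraph \<Rightarrow> real" where
  "conductance H = Min (set_conductance H ` {S. {} \<subset> S \<and> S \<subset> UNIV})"

definition adjacency_matrix :: "'v::finite hypergraph \<Rightarrow> real ^ 'v ^ 'v" where
  "adjacency_matrix H = (\<chi> u v. if u = v then 0
     else (\<Sum>e\<in>{e \<in> hedges H. {u, v} \<subseteq> e}. hweight H e / (real (card e) - 1)))"

definition diagonal_matrix :: "('v \<Rightarrow> real) \<Rightarrow> real ^ 'v ^ 'v::finite" where
  "diagonal_matrix f = (\<chi> u v. if u = v then f u else 0)"

definition laplacian :: "'v::finite hypergraph \<Rightarrow> real ^ 'v ^ 'v" where
  "laplacian H = diagonal_matrix (degree_h H) - adjacency_matrix H"

definition normalized_laplacian :: "'v::finite hypergraph \<Rightarrow> real ^ 'v ^ 'v" where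
  "normalized_laplacian H =
     diagonal_matrix (\<lambda>u. 1 / sqrt (degree_h H u)) ** laplacian H **
     diagonal_matrix (\<lambda>u. 1 / sqrt (degree_h H u))"

definition charpoly :: "real ^ 'v ^ 'v::finite \<Rightarrow> real poly" where
  "charpoly A = det (mat [:0, 1:] - (\<chi> i j. [:A $ i $ j:]))"

text \<open>The real eigenvalues in increasing order, each repeated according to its multiplicity as a
  root of the characteristic polynomial. For a symmetric matrix, such as the normalized Laplacian,
  these are all \<open>CARD('v)\<close> eigenvalues.\<close>

definition eigenvalue_list :: "real ^ 'v ^ 'v::finite \<Rightarrow> real list" where
  "eigenvalue_list A = sorted_list_of_multiset (proots (charpoly A))"

text \<open>\<open>nu H k\<close> is the \<open>k\<close>-th smallest eigenvalue, counting from \<open>k = 1\<close>.\<close>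

definition nu :: "'v::finite hypergraph \<Rightarrow> nat \<Rightarrow> real" where
  "nu H k = eigenvalue_list (normalized_laplacian H) ! (k - 1)"

end

theory Submission
  imports Defs
begin

text \<open>
The proof compares the hypergraph with its clique graph, the weighted graph in which each
hyperedge \<open>e\<close> is replaced by a clique on \<open>e\<close> whose edges have weight \<open>w(e) / (|e| - 1)\<close>. This scaling
makes the weighted degrees of the graph equal to the degrees of the hypergraph, so both have the same
volumes, and the normalized Laplacian of the hypergraph is by definition that of the clique graph.
Only the cuts differ. If \<open>S\<close> splits \<open>e\<close> into parts of sizes \<open>p, q \<ge> 1\<close>, then \<open>e\<close> contributes
\<open>w(e) p q / (p + q - 1)\<close> to the graph cut and \<open>w(e)\<close> to the hypergraph cut, and
\<open>1 \<le> p q / (p + q - 1) \<le> (p + q) / 2\<close>. Hence the hypergraph cut is at most the graph cut, which is at most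
half the rank times the hypergraph cut (\<open>hyperedge_cut_bounds\<close>).
The two bounds now follow from the two halves of Cheeger's inequality
\<open>\<nu>\<^sub>2 / 2 \<le> \<phi> \<le> sqrt (2 \<nu>\<^sub>2)\<close> for weighted graphs, \<open>cheeger_easy\<close> and \<open>cheeger_hard\<close>.

The easy half inserts the indicator function of \<open>S\<close>, shifted to be orthogonal to the constants,
into the Rayleigh quotient. For the hard half, let \<open>y\<close> be an eigenfunction of \<open>\<nu>\<^sub>2\<close> orthogonal to the
constants. It takes both signs, so after a change of sign its positive part \<open>z\<close> is
nonzero and supported on at most half of the volume; passing to \<open>z\<close> does not increase the Rayleigh quotient. By the
Cauchy-Schwarz inequality the total variation of \<open>z\<^sup>2\<close> is at most \<open>sqrt (8 \<nu>\<^sub>2)\<close> times its weighted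
sum, and by slicing \<open>z\<^sup>2\<close> into superlevel sets it is at least \<open>2 \<phi>\<close> times that sum.

Both halves need the variational meaning of \<open>\<nu>\<^sub>2\<close>, which is defined as the second entry of
the sorted list of roots of the characteristic polynomial. The spectral theorem, applied on the
orthogonal complement of the kernel vector \<open>D\<^sup>1\<^sup>/\<^sup>2 1\<close>, yields an orthonormal eigenbasis; the characteristic polynomial splits
along it, so the list consists of the eigenvalue \<open>0\<close> of the kernel vector followed by the sorted
eigenvalues on the complement. Thus \<open>\<nu>\<^sub>2\<close> is the minimum of the Rayleigh quotient on the
complement (\<open>second_eigenvalue_of_psd_with_kernel_vector\<close>), and multiplicities take care of themselves.
\<close>

section \<open>The spectral theorem for self-adjoint maps\<close>

lemma linear_coeff_zero_if_quadratic_nonneg: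
  fixes p q :: real
  assumes "\<And>t. 0 \<le> 2 * t * p + t\<^sup>2 * q"
  shows "p = 0"
proof (rule ccontr)
  assume "p \<noteq> 0"
  define c where "c = \<bar>q\<bar> + 1"
  have c: "c > 0" "q < 2 * c" by (auto simp: c_def)
  \<comment> \<open>At \<open>t = -p / c\<close> the linear term beats the quadratic one, because \<open>c > q / 2\<close>.\<close>
  have "2 * (- p / c) * p + (- p / c)\<^sup>2 * q = (p / c)\<^sup>2 * (q - 2 * c)"
    using c by (simp add: field_simps power2_eq_square)
  moreover have "(p / c)\<^sup>2 * (q - 2 * c) < 0"
    using c \<open>p \<noteq> 0\<close> by (intro mult_pos_neg) auto
  ultimately show False using assms[of "- p / c"] by linarith
qed

text \<open>A unit vector \<open>b\<close> of \<open>S\<close> that minimizes the quadratic form on the compact unit sphere of \<open>S\<close>, with minimum \<open>c\<close>, is an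
eigenvector. Indeed \<open>Q x = x \<bullet> f x - c (x \<bullet> x)\<close> is nonnegative on \<open>S\<close> and vanishes at \<open>b\<close>, so its
derivative at \<open>b\<close> in every direction of \<open>S\<close> is zero; the direction \<open>w = f b - c b\<close> lies in
\<open>S\<close> by invariance, and the derivative in that direction is twice the squared norm of \<open>w\<close>.\<close>

lemma self_adjoint_has_unit_eigenvector:
  fixes f :: "'a::euclidean_space \<Rightarrow> 'a"
  assumes "linear f" and self: "\<And>x y. f x \<bullet> y = x \<bullet> f y"
    and S: "subspace S" "\<And>x. x \<in> S \<Longrightarrow> f x \<in> S" "S \<noteq> {0}"
  shows "\<exists>b\<in>S. norm b = 1 \<and> (\<exists>c. f b = c *\<^sub>R b)"
proof -
  interpret linear f by fact
  have "0 \<in> S" using S(1) by (rule subspace_0)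
  then obtain a where a: "a \<in> S" "a \<noteq> 0" using S(3) by blast
  then have "(1 / norm a) *\<^sub>R a \<in> S \<inter> sphere 0 1"
    using S(1) by (simp add: subspace_mul)
  then have ne: "S \<inter> sphere 0 1 \<noteq> {}" by blast
  have cpt: "compact (S \<inter> sphere 0 1)"
    using closed_subspace[OF S(1)] by (simp add: closed_Int_compact)
  have cont: "continuous_on (S \<inter> sphere 0 1) (\<lambda>x. x \<bullet> f x)"
    by (intro continuous_intros linear_continuous_on) (simp add: linear_linear \<open>linear f\<close> linear_conv_bounded_linear[symmetric])
  obtain b where b: "b \<in> S" "norm b = 1"
    and min: "\<And>x. x \<in> S \<Longrightarrow> norm x = 1 \<Longrightarrow> b \<bullet> f b \<le> x \<bullet> f x"
    using continuous_attains_inf[OF cpt ne cont] by auto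
  define c where "c = b \<bullet> f b"
  have Q: "0 \<le> x \<bullet> f x - c * (x \<bullet> x)" if "x \<in> S" for x
  proof (cases "x = 0")
    case True
    then show ?thesis by (simp add: zero)
  next
    case False
    have "c \<le> ((1 / norm x) *\<^sub>R x) \<bullet> f ((1 / norm x) *\<^sub>R x)"
      unfolding c_def using False that S(1) by (intro min) (auto simp: subspace_mul)
    also have "\<dots> = (x \<bullet> f x) / (norm x)\<^sup>2"
      by (simp add: scale power2_eq_square)
    finally show ?thesis
      using False by (simp add: field_simps dot_square_norm)
  qed
  define w where "w = f b - c *\<^sub>R b"
  have "w \<in> S" using b S by (simp add: w_def subspace_diff subspace_mul)
  have "w \<bullet> w = 0"
  proof (rule linear_coeff_zero_if_quadratic_nonneg)
    fix t :: real
    have bb: "b \<bullet> b = 1" using b by (simp add: norm_eq_1)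
    have sym: "w \<bullet> f b = b \<bullet> f w" using self[of w b] by (simp add: inner_commute)
    have "0 \<le> (b + t *\<^sub>R w) \<bullet> f (b + t *\<^sub>R w) - c * ((b + t *\<^sub>R w) \<bullet> (b + t *\<^sub>R w))"
      using b \<open>w \<in> S\<close> S(1) by (intro Q) (simp add: subspace_add subspace_mul)
    also have "\<dots> = 2 * t * (w \<bullet> f b - c * (w \<bullet> b)) + t\<^sup>2 * (w \<bullet> f w - c * (w \<bullet> w))"
      using sym bb by (simp add: add scale inner_add_left inner_add_right inner_commute[of b w]
          c_def[symmetric] algebra_simps power2_eq_square)
    also have "w \<bullet> f b - c * (w \<bullet> b) = w \<bullet> w"
      by (simp add: w_def inner_diff_right)
    finally show "0 \<le> 2 * t * (w \<bullet> w) + t\<^sup>2 * (w \<bullet> f w - c * (w \<bullet> w))" .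
  qed
  then have "f b = c *\<^sub>R b" by (simp add: w_def)
  with b show ?thesis by blast
qed

definition orthonormal :: "'a::real_inner set \<Rightarrow> bool" where
  "orthonormal B \<longleftrightarrow> pairwise orthogonal B \<and> (\<forall>b\<in>B. norm b = 1)"

lemma orthonormal_inner:
  assumes "orthonormal B" "a \<in> B" "b \<in> B"
  shows "a \<bullet> b = (if a = b then 1 else 0)"
  using assms by (auto simp: orthonormal_def pairwise_def orthogonal_def norm_eq_1)

lemma orthonormal_independent:
  fixes B :: "'a::euclidean_space set"
  assumes "orthonormal B"
  shows "independent B"
  using assms by (intro pairwise_orthogonal_independent) (auto simp: orthonormal_def)

text \<open>Split off a unit eigenvector \<open>b\<close>. Self-adjointness makes the orthogonal complement of \<open>b\<close> in \<open>S\<close>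
invariant again, and its dimension is smaller. Allowing an arbitrary invariant subspace serves the
induction, and later makes it possible to prescribe one vector of the eigenbasis.\<close>

theorem spectral_theorem_on_subspace:
  fixes f :: "'a::euclidean_space \<Rightarrow> 'a"
  assumes f: "linear f" "\<And>x y. f x \<bullet> y = x \<bullet> f y"
    and S: "subspace S" "\<And>x. x \<in> S \<Longrightarrow> f x \<in> S"
  shows "\<exists>B. orthonormal B \<and> span B = S \<and> (\<forall>b\<in>B. \<exists>c. f b = c *\<^sub>R b)"
  using S
proof (induction "dim S" arbitrary: S rule: less_induct)
  case less
  show ?case
  proof (cases "S = {0}")
    case True
    then show ?thesis by (intro exI[of _ "{}"]) (auto simp: orthonormal_def)
  next
    case False
    then obtain b c where b: "b \<in> S" "norm b = 1" and c: "f b = c *\<^sub>R b"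
      using self_adjoint_has_unit_eigenvector[OF f less.prems] by blast
    have bb: "b \<bullet> b = 1" using b by (simp add: norm_eq_1)
    define T where "T = {x \<in> S. b \<bullet> x = 0}"
    have "T = S \<inter> {x. b \<bullet> x = 0}" by (auto simp: T_def)
    then have T: "subspace T"
      using less.prems(1) by (simp add: subspace_inter subspace_hyperplane)
    have "b \<notin> T" using bb by (simp add: T_def)
    moreover have "T \<subseteq> S" by (auto simp: T_def)
    ultimately have "T \<subset> S" using b(1) by blast
    then have "dim T < dim S"
      using T less.prems(1) by (intro dim_psubset) (metis span_eq_iff)
    moreover have "f x \<in> T" if "x \<in> T" for x
      using that less.prems(2)[of x] f(2)[of b x] by (simp add: T_def c)
    ultimately obtain B where B: "orthonormal B" "span B = T" "\<And>x. x \<in> B \<Longrightarrow> \<exists>c. f x = c *\<^sub>R x"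
      using less.hyps[of T] T by blast
    have BT: "B \<subseteq> T" using B(2) span_superset by blast
    have "span (insert b B) = S"
    proof
      show "span (insert b B) \<subseteq> S"
        using b BT less.prems(1) by (intro span_minimal) (auto simp: T_def)
      show "S \<subseteq> span (insert b B)"
      proof
        fix x assume "x \<in> S"
        then have "x - (b \<bullet> x) *\<^sub>R b \<in> T"
          using b bb less.prems(1) by (simp add: T_def subspace_diff subspace_mul inner_diff_right)
        then show "x \<in> span (insert b B)"
          using B(2) by (auto simp: span_insert)
      qed
    qed
    moreover have "orthonormal (insert b B)"
      using B(1) b(2) BT
      by (auto simp: orthonormal_def pairwise_insert T_def orthogonal_def inner_commute)
    ultimately show ?thesis
      using B(3) c by (intro exI[of _ "insert b B"]) auto
  qed
qed

section \<open>The characteristic polynomial along an eigenbasis\<close>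

lemma poly_charpoly: "poly (charpoly A) t = det (mat t - A)"
  for A :: "real ^ 'v ^ 'v::finite"
  unfolding charpoly_def det_def poly_sum poly_mult poly_prod
  by (intro sum.cong prod.cong arg_cong2[of _ _ _ _ "(*)"]) (auto simp: mat_def)

text \<open>Let \<open>P\<close> be the orthogonal matrix with the vectors of \<open>B\<close> as columns and \<open>D\<close> the diagonal matrix with entries
\<open>t - c b\<close>. Then \<open>(t I - A) P = P D\<close>, and the determinant of \<open>P\<close> cancels. The comparison is made for each real \<open>t\<close>,
where this is an identity of real matrices; over an infinite field equal values give equal
polynomials.\<close>

lemma charpoly_eq_prod_over_eigenbasis:
  fixes A :: "real ^ 'v ^ 'v::finite"
  assumes B: "orthonormal B" "span B = UNIV" and ev: "\<And>b. b \<in> B \<Longrightarrow> A *v b = c b *\<^sub>R b"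
  shows "charpoly A = (\<Prod>b\<in>B. [:- c b, 1:])"
proof -
  have ind: "independent B" using B(1) by (rule orthonormal_independent)
  then have fin: "finite B" by (rule independent_imp_finite)
  have "card B = CARD('v)"
    using dim_span_eq_card_independent[OF ind] B(2) by (simp add: dim_UNIV)
  then obtain f :: "'v \<Rightarrow> real ^ 'v" where f: "bij_betw f UNIV B"
    using fin by (metis finite_class.finite_UNIV bij_betw_iff_card)
  then have fB: "f j \<in> B" for j by (auto simp: bij_betw_def)
  define P :: "real ^ 'v ^ 'v" where "P = (\<chi> i j. f j $ i)"
  have "f i \<bullet> f j = (if i = j then 1 else 0)" for i j
    using orthonormal_inner[OF B(1) fB fB] f by (auto simp: bij_betw_def inj_on_def)
  then have "orthogonal_matrix P"
    by (simp add: orthogonal_matrix P_def transpose_def matrix_matrix_mult_def mat_def vec_eq_iff inner_vec_def)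
  then have detP: "det P \<noteq> 0" using det_orthogonal_matrix by fastforce
  have "det (mat t - A) = (\<Prod>b\<in>B. t - c b)" for t
  proof -
    define D :: "real ^ 'v ^ 'v" where "D = (\<chi> i j. if i = j then t - c (f j) else 0)"
    have "(\<Sum>k\<in>UNIV. (mat t - A) $ i $ k * f j $ k) = f j $ i * (t - c (f j))" for i j
    proof -
      have "(\<Sum>k\<in>UNIV. A $ i $ k * f j $ k) = c (f j) * f j $ i"
        using ev[OF fB[of j]] by (auto simp: vec_eq_iff matrix_vector_mult_def)
      moreover have "(\<Sum>k\<in>UNIV. mat t $ i $ k * f j $ k) = t * f j $ i"
        by (simp add: mat_def if_distrib[of "\<lambda>x. x * _"] cong: if_cong)
      ultimately show ?thesis
        by (simp add: left_diff_distrib sum_subtractf right_diff_distrib)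
    qed
    then have "(mat t - A) ** P = P ** D"
      by (simp add: vec_eq_iff matrix_matrix_mult_def P_def D_def if_distrib cong: if_cong)
    then have "det (mat t - A) * det P = det P * det D"
      by (metis det_mul)
    then have "det (mat t - A) = det D" using detP by simp
    also have "\<dots> = (\<Prod>j\<in>UNIV. t - c (f j))"
      by (subst det_diagonal) (auto simp: D_def)
    also have "\<dots> = (\<Prod>b\<in>B. t - c b)"
      using prod.reindex_bij_betw[OF f] .
    finally show ?thesis .
  qed
  then have "poly (charpoly A) = poly (\<Prod>b\<in>B. [:- c b, 1:])"
    by (auto simp: poly_charpoly poly_prod)
  then show ?thesis by (simp only: poly_eq_poly_eq_iff)
qed

lemma eigenvalue_list_eigenbasis:
  fixes A :: "real ^ 'v ^ 'v::finite"
  assumes "orthonormal B" "span B = UNIV" "\<And>b. b \<in> B \<Longrightarrow> A *v b = c b *\<^sub>R b"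
  shows "eigenvalue_list A = sorted_list_of_multiset (image_mset c (mset_set B))"
proof -
  have "finite B" using assms(1) by (intro independent_imp_finite orthonormal_independent)
  then have "proots (\<Prod>b\<in>B. [:- c b, 1:]) = image_mset c (mset_set B)"
    by (subst proots_prod) (auto simp: sum_unfold_sum_mset)
  then show ?thesis
    using charpoly_eq_prod_over_eigenbasis[of B A c] assms by (simp add: eigenvalue_list_def)
qed

section \<open>The second eigenvalue as a minimum\<close>

text \<open>The normalized kernel vector \<open>v0\<close> together with an orthonormal eigenbasis \<open>B\<close> of the complement \<open>T\<close> of \<open>v\<close> is an
eigenbasis of the whole space. Semidefiniteness puts its eigenvalue \<open>0\<close> at the head of the sorted
list, so entry \<open>1\<close> is the least eigenvalue that occurs on \<open>B\<close>; expanding \<open>x\<close> in \<open>B\<close> turns this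
into the lower bound on the quadratic form. The argument covers a kernel of any dimension: if \<open>0\<close> is also an eigenvalue on
\<open>B\<close>, then \<open>l = 0\<close>.\<close>

lemma second_eigenvalue_of_psd_with_kernel_vector:
  fixes M :: "real ^ 'v ^ 'v::finite" and v :: "real ^ 'v"
  assumes sym: "transpose M = M" and psd: "\<And>x. 0 \<le> x \<bullet> (M *v x)"
    and v: "M *v v = 0" "v \<noteq> 0" and card: "2 \<le> CARD('v)"
  defines "l \<equiv> eigenvalue_list M ! 1"
  shows "\<exists>b. b \<noteq> 0 \<and> v \<bullet> b = 0 \<and> M *v b = l *\<^sub>R b"
    and "v \<bullet> x = 0 \<Longrightarrow> l * (x \<bullet> x) \<le> x \<bullet> (M *v x)"
proof -
  have self: "(M *v x) \<bullet> y = x \<bullet> (M *v y)" for x y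
    using dot_lmul_matrix[of x M y] sym by (metis vector_transpose_matrix)
  define T where "T = {x. v \<bullet> x = 0}"
  have "subspace T" by (simp add: T_def subspace_hyperplane)
  moreover have "M *v x \<in> T" if "x \<in> T" for x
    using self[of v x] v(1) by (simp add: T_def)
  ultimately obtain B where B: "orthonormal B" "span B = T"
    and ev: "\<And>b. b \<in> B \<Longrightarrow> \<exists>c. M *v b = c *\<^sub>R b"
    using spectral_theorem_on_subspace[of "(*v) M" T] self by auto
  define c where "c b = b \<bullet> (M *v b)" for b
  have BT: "B \<subseteq> T" using B(2) span_superset by blast
  have evB: "M *v b = c b *\<^sub>R b" if "b \<in> B" for b
    using ev[OF that] orthonormal_inner[OF B(1) that that] by (auto simp: c_def)
  have finB: "finite B" using B(1) by (intro independent_imp_finite orthonormal_independent)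
  define v0 where "v0 = (1 / norm v) *\<^sub>R v"
  have v0: "norm v0 = 1" "M *v v0 = 0" "c v0 = 0" "v0 \<notin> T"
    using v by (auto simp: v0_def c_def T_def matrix_vector_mult_scaleR)
  define B' where "B' = insert v0 B"
  have B': "orthonormal B'"
    using B(1) v0 BT
    by (auto simp: B'_def v0_def orthonormal_def pairwise_insert T_def orthogonal_def inner_commute)
  have spanB': "span B' = UNIV"
  proof -
    have "x - ((v \<bullet> x) / norm v) *\<^sub>R v0 \<in> T" for x
      using v(2) by (simp add: T_def v0_def inner_diff_right dot_square_norm power2_eq_square)
    then have "x \<in> span B'" for x
      using B(2) by (auto simp: B'_def span_insert)
    then show ?thesis by blast
  qed
  have evB': "M *v b = c b *\<^sub>R b" if "b \<in> B'" for b
    using that evB v0 by (auto simp: B'_def)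
  have "card B' = CARD('v)"
    using dim_span_eq_card_independent[OF orthonormal_independent[OF B']] spanB' by simp
  then have "B \<noteq> {}" using card by (auto simp: B'_def)
  define L where "L = sorted_list_of_multiset (image_mset c (mset_set B))"
  have setL: "set L = c ` B" using finB by (simp add: L_def)
  have "v0 \<notin> B" using v0 BT by blast
  then have "image_mset c (mset_set B') = add_mset 0 (image_mset c (mset_set B))"
    using finB v0(3) by (simp add: B'_def)
  then have "eigenvalue_list M = insort 0 L"
    using eigenvalue_list_eigenbasis[OF B' spanB' evB'] by (simp add: L_def)
  also have "\<dots> = 0 # L"
    using setL psd by (intro insort_is_Cons) (auto simp: c_def)
  finally have l: "l = L ! 0" by (simp add: l_def)
  have "L \<noteq> []" using setL \<open>B \<noteq> {}\<close> by auto
  then have "l \<in> c ` B" using l setL by (metis length_greater_0_conv nth_mem)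
  then obtain b where b: "b \<in> B" "c b = l" by blast
  have lmin: "l \<le> c b" if "b \<in> B" for b
  proof -
    have "sorted L" by (simp add: L_def)
    then have "\<forall>x\<in>set L. L ! 0 \<le> x" using \<open>L \<noteq> []\<close> by (cases L) auto
    then show ?thesis using that setL l by auto
  qed
  have "norm b = 1" "b \<in> T" using b B(1) BT by (auto simp: orthonormal_def)
  then show "\<exists>b. b \<noteq> 0 \<and> v \<bullet> b = 0 \<and> M *v b = l *\<^sub>R b"
    using evB[of b] b by (intro exI[of _ b]) (auto simp: T_def)
  assume "v \<bullet> x = 0"
  then have "x \<in> span B" using B(2) by (simp add: T_def)
  then have exp: "(\<Sum>b\<in>B. (x \<bullet> b) *\<^sub>R b) = x"
    using B(1) finB by (intro orthonormal_basis_expand) (auto simp: orthonormal_def)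
  have coord: "x \<bullet> y = (\<Sum>b\<in>B. (x \<bullet> b) * (b \<bullet> y))" for y
    by (subst exp[symmetric]) (simp add: inner_sum_left)
  have "l * (x \<bullet> x) = (\<Sum>b\<in>B. l * (x \<bullet> b)\<^sup>2)"
    by (subst coord) (simp add: sum_distrib_left inner_commute power2_eq_square)
  also have "\<dots> \<le> (\<Sum>b\<in>B. c b * (x \<bullet> b)\<^sup>2)"
    by (intro sum_mono mult_right_mono lmin) auto
  also have "\<dots> = (\<Sum>b\<in>B. (x \<bullet> b) * (b \<bullet> (M *v x)))"
    using evB by (intro sum.cong) (auto simp: self[symmetric] inner_commute power2_eq_square)
  also have "\<dots> = x \<bullet> (M *v x)" by (rule coord[symmetric])
  finally show "l * (x \<bullet> x) \<le> x \<bullet> (M *v x)" .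
qed

section \<open>The Laplacian of a weighted graph\<close>

text \<open>Loops are permitted: they enlarge the degrees but cancel in the Laplacian. With at least two
vertices the second eigenvalue exists.\<close>

locale weighted_graph =
  fixes a :: "'v::finite \<Rightarrow> 'v \<Rightarrow> real"
  assumes sym: "a u v = a v u" and nonneg: "0 \<le> a u v"
    and row_sum_pos: "0 < (\<Sum>v\<in>UNIV. a u v)"
    and card: "2 \<le> CARD('v)"
begin

definition deg :: "'v \<Rightarrow> real" where
  "deg u = (\<Sum>v\<in>UNIV. a u v)"

definition vol :: "'v set \<Rightarrow> real" where
  "vol S = (\<Sum>u\<in>S. deg u)"

definition cut :: "'v set \<Rightarrow> real" where
  "cut S = (\<Sum>u\<in>S. \<Sum>v\<in>-S. a u v)"

definition energy :: "('v \<Rightarrow> real) \<Rightarrow> real" where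
  "energy y = (\<Sum>u\<in>UNIV. \<Sum>v\<in>UNIV. a u v * (y u - y v)\<^sup>2) / 2"

text \<open>The matrix \<open>D\<^sup>-\<^sup>1\<^sup>/\<^sup>2 (D - a) D\<^sup>-\<^sup>1\<^sup>/\<^sup>2\<close>, written entrywise.\<close>

definition norm_lap :: "real ^ 'v ^ 'v" where
  "norm_lap = (\<chi> u v. ((if u = v then deg u else 0) - a u v) / (sqrt (deg u) * sqrt (deg v)))"

definition lambda2 :: real where
  "lambda2 = eigenvalue_list norm_lap ! 1"

lemma deg_pos: "0 < deg u"
  using row_sum_pos by (simp add: deg_def)

lemma sum_weights_fst: "(\<Sum>u\<in>UNIV. \<Sum>v\<in>UNIV. a u v * f u) = (\<Sum>u\<in>UNIV. deg u * f u)"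
  by (simp add: deg_def sum_distrib_right)

lemma sum_weights_snd: "(\<Sum>u\<in>UNIV. \<Sum>v\<in>UNIV. a u v * f v) = (\<Sum>u\<in>UNIV. deg u * f u)"
  by (subst sum.swap) (simp add: deg_def sum_distrib_right sym)

lemma energy_eq_laplacian_form:
  "energy y = (\<Sum>u\<in>UNIV. y u * (deg u * y u - (\<Sum>v\<in>UNIV. a u v * y v)))"
proof -
  have "2 * energy y
      = (\<Sum>u\<in>UNIV. \<Sum>v\<in>UNIV. a u v * (y u)\<^sup>2 + a u v * (y v)\<^sup>2 - 2 * (y u * (a u v * y v)))"
    unfolding energy_def by (simp add: power2_diff algebra_simps)
  also have "\<dots> = (\<Sum>u\<in>UNIV. \<Sum>v\<in>UNIV. a u v * (y u)\<^sup>2) + (\<Sum>u\<in>UNIV. \<Sum>v\<in>UNIV. a u v * (y v)\<^sup>2)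
      - 2 * (\<Sum>u\<in>UNIV. \<Sum>v\<in>UNIV. y u * (a u v * y v))"
    by (simp add: sum.distrib sum_subtractf sum_distrib_left)
  also have "\<dots> = 2 * (\<Sum>u\<in>UNIV. deg u * (y u)\<^sup>2) - 2 * (\<Sum>u\<in>UNIV. \<Sum>v\<in>UNIV. y u * (a u v * y v))"
    unfolding sum_weights_fst sum_weights_snd by simp
  finally have "energy y = (\<Sum>u\<in>UNIV. deg u * (y u)\<^sup>2) - (\<Sum>u\<in>UNIV. \<Sum>v\<in>UNIV. y u * (a u v * y v))"
    by linarith
  then show ?thesis
    by (simp add: sum_distrib_left right_diff_distrib sum_subtractf power2_eq_square ac_simps)
qed

text \<open>The substitution \<open>x = D\<^sup>1\<^sup>/\<^sup>2 y\<close> turns the normalized Laplacian into the plain Laplacian, and the kernel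
vector \<open>D\<^sup>1\<^sup>/\<^sup>2 1\<close> into the constant function. In terms of \<open>y\<close>
all square roots of degrees disappear from the eigenvalue equation and from the Rayleigh quotient.\<close>

lemma norm_lap_mult:
  "(norm_lap *v (\<chi> u. sqrt (deg u) * y u)) $ u = (deg u * y u - (\<Sum>v\<in>UNIV. a u v * y v)) / sqrt (deg u)"
proof -
  have "(norm_lap *v (\<chi> u. sqrt (deg u) * y u)) $ u
      = (\<Sum>v\<in>UNIV. ((if u = v then deg u * y v else 0) - a u v * y v) / sqrt (deg u))"
    unfolding matrix_vector_mult_def norm_lap_def
    using deg_pos by (auto intro!: sum.cong simp: field_simps less_imp_neq[symmetric])
  also have "\<dots> = (\<Sum>v\<in>UNIV. (if u = v then deg u * y v else 0) - a u v * y v) / sqrt (deg u)"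
    by (simp add: sum_divide_distrib)
  finally show ?thesis by (simp add: sum_subtractf)
qed

lemma norm_lap_form:
  "(\<chi> u. sqrt (deg u) * y u) \<bullet> (norm_lap *v (\<chi> u. sqrt (deg u) * y u)) = energy y"
  unfolding inner_vec_def norm_lap_mult energy_eq_laplacian_form
  using deg_pos by (auto intro!: sum.cong simp: less_imp_neq[symmetric])

lemma vec_eq_sqrt_degree_scaled: "x = (\<chi> u. sqrt (deg u) * (x $ u / sqrt (deg u)))"
  using deg_pos by (auto simp: vec_eq_iff less_imp_neq[symmetric])

lemma energy_nonneg: "0 \<le> energy y"
  unfolding energy_def by (simp add: sum_nonneg nonneg)

lemma norm_lap_second_eigenvalue_hyps:
  "transpose norm_lap = norm_lap" "\<And>x. 0 \<le> x \<bullet> (norm_lap *v x)"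
  "norm_lap *v (\<chi> u. sqrt (deg u)) = 0" "(\<chi> u. sqrt (deg u)) \<noteq> (0 :: real ^ 'v)"
proof -
  show "transpose norm_lap = norm_lap"
    by (auto simp: transpose_def norm_lap_def vec_eq_iff sym mult.commute)
  show "0 \<le> x \<bullet> (norm_lap *v x)" for x
    by (subst (1 2) vec_eq_sqrt_degree_scaled) (simp only: norm_lap_form energy_nonneg)
  show "norm_lap *v (\<chi> u. sqrt (deg u)) = 0"
    using norm_lap_mult[of "\<lambda>_. 1"] by (simp add: vec_eq_iff deg_def)
  show "(\<chi> u. sqrt (deg u)) \<noteq> (0 :: real ^ 'v)"
    using deg_pos by (auto simp: vec_eq_iff less_imp_neq[symmetric])
qed

lemmas second_eigenvalue =
  second_eigenvalue_of_psd_with_kernel_vector[OF norm_lap_second_eigenvalue_hyps card, folded lambda2_def]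

lemma lambda2_eigenfunction:
  "\<exists>y. (\<exists>u. y u \<noteq> 0) \<and> (\<Sum>u\<in>UNIV. deg u * y u) = 0
      \<and> (\<forall>u. deg u * y u - (\<Sum>v\<in>UNIV. a u v * y v) = lambda2 * (deg u * y u))"
proof -
  obtain b where b: "b \<noteq> 0" "(\<chi> u. sqrt (deg u)) \<bullet> b = 0" "norm_lap *v b = lambda2 *\<^sub>R b"
    using second_eigenvalue(1) by blast
  define y where "y u = b $ u / sqrt (deg u)" for u
  have b_eq: "b = (\<chi> u. sqrt (deg u) * y u)"
    unfolding y_def by (rule vec_eq_sqrt_degree_scaled)
  have "\<exists>u. y u \<noteq> 0" using b(1) b_eq by (auto simp: vec_eq_iff)
  moreover have "(\<Sum>u\<in>UNIV. deg u * y u) = 0"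
    using b(2) deg_pos[THEN less_imp_le] by (simp add: b_eq inner_vec_def flip: mult.assoc)
  moreover have "deg u * y u - (\<Sum>v\<in>UNIV. a u v * y v) = lambda2 * (deg u * y u)" for u
  proof -
    have "(deg u * y u - (\<Sum>v\<in>UNIV. a u v * y v)) / sqrt (deg u) = lambda2 * (sqrt (deg u) * y u)"
      using norm_lap_mult[of y u] b(3) by (simp add: b_eq)
    then have "deg u * y u - (\<Sum>v\<in>UNIV. a u v * y v) = lambda2 * (sqrt (deg u) * sqrt (deg u) * y u)"
      using deg_pos[of u] by (simp add: field_simps)
    then show ?thesis using deg_pos[of u] by simp
  qed
  ultimately show ?thesis by blast
qed

lemma lambda2_le_rayleigh:
  assumes "(\<Sum>u\<in>UNIV. deg u * y u) = 0"
  shows "lambda2 * (\<Sum>u\<in>UNIV. deg u * (y u)\<^sup>2) \<le> energy y"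
proof -
  have "(\<chi> u. sqrt (deg u)) \<bullet> (\<chi> u. sqrt (deg u) * y u) = 0"
    using assms deg_pos[THEN less_imp_le] by (simp add: inner_vec_def flip: mult.assoc)
  then have "lambda2 * ((\<chi> u. sqrt (deg u) * y u) \<bullet> (\<chi> u. sqrt (deg u) * y u)) \<le> energy y"
    using second_eigenvalue(2) norm_lap_form by metis
  moreover have "sqrt (deg u) * y u * (sqrt (deg u) * y u) = deg u * (y u)\<^sup>2" for u
  proof -
    have "sqrt (deg u) * y u * (sqrt (deg u) * y u) = (sqrt (deg u))\<^sup>2 * (y u)\<^sup>2"
      by (simp add: power2_eq_square)
    then show ?thesis using deg_pos[of u] by simp
  qed
  ultimately show ?thesis by (simp add: inner_vec_def)
qed

section \<open>Cheeger's inequality for weighted graphs\<close>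

lemma vol_mono: "S \<subseteq> T \<Longrightarrow> vol S \<le> vol T"
  unfolding vol_def using deg_pos[THEN less_imp_le] by (intro sum_mono2) auto

lemma vol_pos: "S \<noteq> {} \<Longrightarrow> 0 < vol S"
  unfolding vol_def using deg_pos by (intro sum_pos) auto

lemma vol_Un_disjoint: "S \<inter> T = {} \<Longrightarrow> vol (S \<union> T) = vol S + vol T"
  unfolding vol_def by (intro sum.union_disjoint) auto

lemma vol_Compl: "vol S + vol (- S) = vol UNIV"
  by (subst vol_Un_disjoint[symmetric]) auto

lemma sum_indicator: "(\<Sum>u\<in>UNIV. f u * of_bool (u \<in> S)) = sum f S"
  for f :: "'v \<Rightarrow> real"
  by (simp add: of_bool_def if_distrib[of "(*) _"] sum.If_cases cong: if_cong)

lemma total_variation_indicator: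
  "(\<Sum>u\<in>UNIV. \<Sum>v\<in>UNIV. a u v * \<bar>of_bool (u \<in> S) - of_bool (v \<in> S)\<bar>) = 2 * cut S"
proof -
  have 1: "(\<Sum>u\<in>UNIV. \<Sum>v\<in>UNIV. a u v * of_bool (v \<in> -S) * of_bool (u \<in> S)) = cut S"
    by (simp only: cut_def sum_indicator sum_distrib_right[symmetric])
  have 2: "(\<Sum>u\<in>UNIV. \<Sum>v\<in>UNIV. a u v * of_bool (u \<in> -S) * of_bool (v \<in> S)) = cut S"
    by (subst sum.swap) (simp add: 1[symmetric] sym)
  have "(\<Sum>u\<in>UNIV. \<Sum>v\<in>UNIV. a u v * \<bar>of_bool (u \<in> S) - of_bool (v \<in> S)\<bar>)
      = (\<Sum>u\<in>UNIV. \<Sum>v\<in>UNIV. a u v * of_bool (v \<in> -S) * of_bool (u \<in> S)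
          + a u v * of_bool (u \<in> -S) * of_bool (v \<in> S))"
    by (intro sum.cong) auto
  then show ?thesis using 1 2 by (simp only: sum.distrib)
qed

lemma energy_shifted_indicator: "energy (\<lambda>u. of_bool (u \<in> S) - c) = cut S"
proof -
  have "(\<Sum>u\<in>UNIV. \<Sum>v\<in>UNIV. a u v * (of_bool (u \<in> S) - c - (of_bool (v \<in> S) - c))\<^sup>2)
      = (\<Sum>u\<in>UNIV. \<Sum>v\<in>UNIV. a u v * \<bar>of_bool (u \<in> S) - of_bool (v \<in> S)\<bar>)"
    by (intro sum.cong) auto
  then show ?thesis using total_variation_indicator by (simp add: energy_def)
qed

text \<open>Subtracting its weighted mean \<open>m = vol S / vol UNIV\<close> from the indicator function of \<open>S\<close> makes it a test function for the
Rayleigh quotient. Its energy is the cut, and its weighted square sum is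
\<open>vol S (1 - m) = vol S vol (- S) / vol UNIV\<close>.\<close>

lemma cheeger_easy: "lambda2 * (vol S * vol (- S)) \<le> cut S * vol UNIV"
proof -
  have V: "0 < vol UNIV" by (rule vol_pos) simp
  define m where "m = vol S / vol UNIV"
  have mV: "m * vol UNIV = vol S" using V by (simp add: m_def)
  let ?y = "\<lambda>u. of_bool (u \<in> S) - m"
  have "(\<Sum>u\<in>UNIV. deg u * ?y u) = (\<Sum>u\<in>UNIV. deg u * of_bool (u \<in> S) - m * deg u)"
    by (simp add: algebra_simps)
  also have "\<dots> = vol S - m * vol UNIV"
    unfolding sum_subtractf sum_indicator by (simp add: vol_def sum_distrib_left)
  finally have "lambda2 * (\<Sum>u\<in>UNIV. deg u * (?y u)\<^sup>2) \<le> cut S"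
    using lambda2_le_rayleigh[of ?y] mV by (simp add: energy_shifted_indicator)
  also have "(\<Sum>u\<in>UNIV. deg u * (?y u)\<^sup>2) = (\<Sum>u\<in>UNIV. (1 - 2 * m) * (deg u * of_bool (u \<in> S)) + m\<^sup>2 * deg u)"
    by (intro sum.cong) (auto simp: power2_eq_square algebra_simps)
  also have "\<dots> = (1 - 2 * m) * vol S + m * (m * vol UNIV)"
    unfolding sum.distrib sum_distrib_left[symmetric] sum_indicator by (simp add: vol_def power2_eq_square)
  also have "\<dots> = (1 - m) * vol S" unfolding mV by (simp add: algebra_simps)
  finally have "lambda2 * ((1 - m) * vol S) * vol UNIV \<le> cut S * vol UNIV"
    using V by (intro mult_right_mono) auto
  moreover have "(1 - m) * vol UNIV = vol (- S)"
    using mV vol_Compl[of S] by (simp add: algebra_simps)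
  ultimately show ?thesis
    by (metis (no_types, opaque_lifting) mult.assoc mult.commute)
qed

text \<open>A discrete coarea argument. Let \<open>S\<close> be the support of \<open>f\<close> and \<open>m\<close> the least positive value. Removing
the layer \<open>m 1\<^sub>S\<close> leaves a nonnegative function \<open>g\<close> with strictly smaller support. The map \<open>f \<mapsto> g\<close> is monotone in
the values of \<open>f\<close>, so the total variations of \<open>g\<close> and of the layer add up to that of \<open>f\<close>, while the
isoperimetric hypothesis bounds the contribution \<open>2 m cut S\<close> of the layer from below.\<close>

lemma total_variation_ge:
  assumes iso: "\<And>S. S \<noteq> {} \<Longrightarrow> vol S \<le> vol (- S) \<Longrightarrow> p * vol S \<le> cut S"
    and "\<And>u. 0 \<le> f u" "vol {u. 0 < f u} \<le> vol (- {u. 0 < f u})"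
  shows "2 * p * (\<Sum>u\<in>UNIV. deg u * f u) \<le> (\<Sum>u\<in>UNIV. \<Sum>v\<in>UNIV. a u v * \<bar>f u - f v\<bar>)"
  using assms(2,3)
proof (induction "card {u. 0 < f u}" arbitrary: f rule: less_induct)
  case less
  define S where "S = {u. 0 < f u}"
  show ?case
  proof (cases "S = {}")
    case True
    then have "f u = 0" for u using less.prems(1)[of u] by (auto simp: S_def order_less_le)
    then show ?thesis by simp
  next
    case False
    define m where "m = Min (f ` S)"
    have "m \<in> f ` S" using False by (auto simp: m_def)
    then obtain x where x: "x \<in> S" "f x = m" by blast
    have "0 < m" using x by (auto simp: S_def)
    have m_le: "m \<le> f u" if "u \<in> S" for u using that by (simp add: m_def)
    have f0: "f u = 0" if "u \<notin> S" for u
      using that less.prems(1)[of u] by (auto simp: S_def)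
    define g where "g u = f u - m * of_bool (u \<in> S)" for u
    have g: "0 \<le> g u" for u using m_le[of u] f0[of u] by (auto simp: g_def)
    have "{u. 0 < g u} \<subseteq> S" using f0 by (auto simp: g_def)
    moreover have "x \<notin> {u. 0 < g u}" using x by (simp add: g_def)
    ultimately have sub: "{u. 0 < g u} \<subset> S" using x(1) by blast
    have "vol {u. 0 < g u} \<le> vol S" using sub by (intro vol_mono) auto
    also have "\<dots> \<le> vol (- S)" using less.prems(2) by (simp add: S_def)
    also have "\<dots> \<le> vol (- {u. 0 < g u})" using sub by (intro vol_mono) auto
    finally have IH: "2 * p * (\<Sum>u\<in>UNIV. deg u * g u) \<le> (\<Sum>u\<in>UNIV. \<Sum>v\<in>UNIV. a u v * \<bar>g u - g v\<bar>)"
      using less.hyps[of g] g sub by (simp add: psubset_card_mono S_def)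
    have "p * vol S \<le> cut S" using iso[OF False] less.prems(2) by (simp add: S_def)
    then have layer: "2 * p * (m * vol S) \<le> m * (2 * cut S)"
      using \<open>0 < m\<close> mult_left_mono[of "p * vol S" "cut S" m] by (simp add: ac_simps)
    have "(\<Sum>u\<in>UNIV. deg u * f u) = (\<Sum>u\<in>UNIV. deg u * g u + m * (deg u * of_bool (u \<in> S)))"
      by (simp add: g_def algebra_simps)
    also have "\<dots> = (\<Sum>u\<in>UNIV. deg u * g u) + m * vol S"
      unfolding sum.distrib sum_distrib_left[symmetric] sum_indicator by (simp add: vol_def)
    finally have split: "(\<Sum>u\<in>UNIV. deg u * f u) = (\<Sum>u\<in>UNIV. deg u * g u) + m * vol S" .
    have "\<bar>f u - f v\<bar> = \<bar>g u - g v\<bar> + m * \<bar>of_bool (u \<in> S) - of_bool (v \<in> S)\<bar>" for u v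
      using m_le[of u] m_le[of v] f0[of u] f0[of v] \<open>0 < m\<close> by (auto simp: g_def)
    then have "(\<Sum>u\<in>UNIV. \<Sum>v\<in>UNIV. a u v * \<bar>f u - f v\<bar>)
        = (\<Sum>u\<in>UNIV. \<Sum>v\<in>UNIV. a u v * \<bar>g u - g v\<bar>
            + m * (a u v * \<bar>of_bool (u \<in> S) - of_bool (v \<in> S)\<bar>))"
      by (simp add: algebra_simps)
    also have "\<dots> = (\<Sum>u\<in>UNIV. \<Sum>v\<in>UNIV. a u v * \<bar>g u - g v\<bar>) + m * (2 * cut S)"
      unfolding sum.distrib sum_distrib_left[symmetric] total_variation_indicator by simp
    finally show ?thesis using IH layer split by (simp add: distrib_left)
  qed
qed

text \<open>Factor \<open>z u\<^sup>2 - z v\<^sup>2 = (z u - z v) (z u + z v)\<close> and apply the Cauchy-Schwarz inequality to the sum over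
all ordered pairs. The first factor gives \<open>2 energy z\<close>. The second, \<open>R\<close>, is at most four times the weighted square sum of \<open>z\<close>
by the parallelogram identity.\<close>

lemma squared_total_variation_le:
  "(\<Sum>u\<in>UNIV. \<Sum>v\<in>UNIV. a u v * \<bar>(z u)\<^sup>2 - (z v)\<^sup>2\<bar>)\<^sup>2 \<le> 8 * energy z * (\<Sum>u\<in>UNIV. deg u * (z u)\<^sup>2)"
proof -
  define D where "D = (\<Sum>u\<in>UNIV. deg u * (z u)\<^sup>2)"
  define R where "R = (\<Sum>u\<in>UNIV. \<Sum>v\<in>UNIV. a u v * (z u + z v)\<^sup>2)"
  have "R + 2 * energy z = (\<Sum>u\<in>UNIV. \<Sum>v\<in>UNIV. a u v * (2 * (z u)\<^sup>2) + a u v * (2 * (z v)\<^sup>2))"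
    unfolding R_def energy_def by (simp add: power2_sum power2_diff algebra_simps flip: sum.distrib)
  also have "\<dots> = 2 * (2 * D)"
    unfolding sum.distrib sum_weights_fst sum_weights_snd D_def by (simp add: sum_distrib_left ac_simps)
  finally have R: "R \<le> 4 * D" using energy_nonneg[of z] by simp
  let ?s = "\<lambda>(u, v). sqrt (a u v) * \<bar>z u - z v\<bar>" and ?t = "\<lambda>(u, v). sqrt (a u v) * \<bar>z u + z v\<bar>"
  have "(\<Sum>u\<in>UNIV. \<Sum>v\<in>UNIV. a u v * \<bar>(z u)\<^sup>2 - (z v)\<^sup>2\<bar>) = (\<Sum>i\<in>UNIV. ?s i * ?t i)"
  proof -
    have "a u v * \<bar>(z u)\<^sup>2 - (z v)\<^sup>2\<bar> = ?s (u, v) * ?t (u, v)" for u v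
    proof -
      have "(z u)\<^sup>2 - (z v)\<^sup>2 = (z u - z v) * (z u + z v)"
        by (simp add: power2_eq_square algebra_simps)
      moreover have "a u v = sqrt (a u v) * sqrt (a u v)" using nonneg[of u v] by simp
      ultimately show ?thesis by (simp add: abs_mult ac_simps)
    qed
    then show ?thesis by (simp add: sum.cartesian_product case_prod_beta)
  qed
  also have "(\<Sum>i\<in>UNIV. ?s i * ?t i)\<^sup>2 \<le> (\<Sum>i\<in>UNIV. (?s i)\<^sup>2) * (\<Sum>i\<in>UNIV. (?t i)\<^sup>2)"
    by (rule Cauchy_Schwarz_ineq_sum)
  also have "(\<Sum>i\<in>UNIV. (?s i)\<^sup>2) = 2 * energy z"
    unfolding energy_def by (simp add: sum.cartesian_product case_prod_beta power_mult_distrib nonneg)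
  also have "(\<Sum>i\<in>UNIV. (?t i)\<^sup>2) = R"
    unfolding R_def by (simp add: sum.cartesian_product case_prod_beta power_mult_distrib nonneg)
  also have "2 * energy z * R \<le> 2 * energy z * (4 * D)"
    using R energy_nonneg[of z] by (intro mult_left_mono) auto
  finally show ?thesis by (simp add: D_def)
qed

text \<open>Where \<open>y\<close> is positive, replacing \<open>y\<close> by its positive part only raises the values at the neighbours, hence
lowers the Laplacian at that vertex; the other vertices are multiplied by zero.\<close>

lemma energy_positive_part_le:
  assumes "\<And>u. deg u * y u - (\<Sum>v\<in>UNIV. a u v * y v) = l * (deg u * y u)"
  shows "energy (\<lambda>u. max (y u) 0) \<le> l * (\<Sum>u\<in>UNIV. deg u * (max (y u) 0)\<^sup>2)"
proof -
  define z where "z u = max (y u) 0" for u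
  have "z u * (deg u * z u - (\<Sum>v\<in>UNIV. a u v * z v)) \<le> l * (deg u * (z u)\<^sup>2)" for u
  proof (cases "0 < y u")
    case True
    then have zu: "z u = y u" by (simp add: z_def)
    have "(\<Sum>v\<in>UNIV. a u v * y v) \<le> (\<Sum>v\<in>UNIV. a u v * z v)"
      by (intro sum_mono mult_left_mono nonneg) (simp add: z_def)
    then have "deg u * z u - (\<Sum>v\<in>UNIV. a u v * z v) \<le> l * (deg u * y u)"
      using assms[of u] zu by simp
    then show ?thesis
      using True mult_left_mono[of _ _ "y u"] by (fastforce simp: zu power2_eq_square ac_simps)
  qed (simp add: z_def)
  then have "energy z \<le> (\<Sum>u\<in>UNIV. l * (deg u * (z u)\<^sup>2))"
    unfolding energy_eq_laplacian_form by (intro sum_mono)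
  then show ?thesis unfolding z_def sum_distrib_left .
qed

lemma cheeger_hard_for_eigenfunction:
  assumes iso: "\<And>S. S \<noteq> {} \<Longrightarrow> vol S \<le> vol (- S) \<Longrightarrow> p * vol S \<le> cut S" and "0 \<le> p"
    and y: "\<And>u. deg u * y u - (\<Sum>v\<in>UNIV. a u v * y v) = l * (deg u * y u)"
    and pos: "0 < y x" and half: "vol {u. 0 < y u} \<le> vol (- {u. 0 < y u})"
  shows "p\<^sup>2 \<le> 2 * l"
proof -
  define z where "z u = max (y u) 0" for u
  define D where "D = (\<Sum>u\<in>UNIV. deg u * (z u)\<^sup>2)"
  have "0 < D"
    unfolding D_def
  proof (rule sum_pos2[of _ x])
    show "0 < deg x * (z x)\<^sup>2" using pos deg_pos[of x] by (simp add: z_def)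
  qed (auto simp: deg_pos[THEN less_imp_le])
  have "{u. 0 < (z u)\<^sup>2} = {u. 0 < y u}" by (auto simp: z_def max_def)
  then have "2 * p * D \<le> (\<Sum>u\<in>UNIV. \<Sum>v\<in>UNIV. a u v * \<bar>(z u)\<^sup>2 - (z v)\<^sup>2\<bar>)"
    using total_variation_ge[OF iso, of "\<lambda>u. (z u)\<^sup>2"] half by (simp add: D_def)
  then have "(2 * p * D)\<^sup>2 \<le> (\<Sum>u\<in>UNIV. \<Sum>v\<in>UNIV. a u v * \<bar>(z u)\<^sup>2 - (z v)\<^sup>2\<bar>)\<^sup>2"
    using \<open>0 < D\<close> \<open>0 \<le> p\<close> by (intro power_mono) auto
  also have "\<dots> \<le> 8 * energy z * D"
    using squared_total_variation_le by (simp add: D_def)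
  also have "\<dots> \<le> 8 * (l * D) * D"
    using energy_positive_part_le[OF y, folded z_def] \<open>0 < D\<close>
    by (intro mult_right_mono mult_left_mono) (simp_all add: D_def)
  finally have "p\<^sup>2 * D\<^sup>2 \<le> 2 * l * D\<^sup>2" by (simp add: power2_eq_square ac_simps)
  then show ?thesis using \<open>0 < D\<close> by simp
qed

text \<open>An eigenfunction \<open>y\<close> with weighted mean zero takes both signs. The sets where \<open>y\<close> is positive
and where it is negative are disjoint, so one of them has at most half of the volume, and \<open>y\<close> or \<open>-y\<close> meets
the hypotheses of \<open>cheeger_hard_for_eigenfunction\<close>.\<close>

theorem cheeger_hard:
  assumes iso: "\<And>S. S \<noteq> {} \<Longrightarrow> vol S \<le> vol (- S) \<Longrightarrow> p * vol S \<le> cut S" and "0 \<le> p"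
  shows "p\<^sup>2 \<le> 2 * lambda2"
proof -
  obtain y w where y: "y w \<noteq> 0" "(\<Sum>u\<in>UNIV. deg u * y u) = 0"
    and ev: "\<And>u. deg u * y u - (\<Sum>v\<in>UNIV. a u v * y v) = lambda2 * (deg u * y u)"
    using lambda2_eigenfunction by blast
  have sgn: "\<exists>x. 0 < h x" if "h w \<noteq> 0" "(\<Sum>u\<in>UNIV. deg u * h u) = 0" for h
  proof (rule ccontr)
    assume "\<not> ?thesis"
    then have "h u \<le> 0" for u by (simp add: not_less)
    then have "0 \<le> deg u * (- h u)" for u using deg_pos[of u] by (intro mult_nonneg_nonneg) auto
    moreover have "(\<Sum>u\<in>UNIV. deg u * (- h u)) = 0" using that(2) by (simp add: sum_negf)
    ultimately have "deg w * (- h w) = 0" by (subst (asm) sum_nonneg_eq_0_iff) auto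
    then show False using that(1) deg_pos[of w] by simp
  qed
  show ?thesis
  proof (cases "vol {u. 0 < y u} \<le> vol (- {u. 0 < y u})")
    case True
    then show ?thesis
      using cheeger_hard_for_eigenfunction[OF iso \<open>0 \<le> p\<close> ev] sgn[of y] y by blast
  next
    case False
    have "vol {u. 0 < - y u} \<le> vol (- {u. 0 < y u})" by (intro vol_mono) auto
    also have "\<dots> \<le> vol {u. 0 < y u}" using False by simp
    also have "\<dots> \<le> vol (- {u. 0 < - y u})" by (intro vol_mono) auto
    finally have "vol {u. 0 < - y u} \<le> vol (- {u. 0 < - y u})" .
    moreover obtain x where "0 < - y x" using sgn[of "\<lambda>u. - y u"] y by (auto simp: sum_negf)
    moreover have "deg u * (- y u) - (\<Sum>v\<in>UNIV. a u v * (- y v)) = lambda2 * (deg u * (- y u))" for u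
      using ev[of u] by (simp add: sum_negf)
    ultimately show ?thesis
      using cheeger_hard_for_eigenfunction[OF iso \<open>0 \<le> p\<close>, of "\<lambda>u. - y u"] by blast
  qed
qed

end

section \<open>The clique graph of a hypergraph\<close>

definition clique_weight :: "'v::finite hypergraph \<Rightarrow> 'v \<Rightarrow> 'v \<Rightarrow> real" where
  "clique_weight H u v = adjacency_matrix H $ u $ v"

abbreviation edge_share :: "'v::finite hypergraph \<Rightarrow> 'v set \<Rightarrow> real" where
  "edge_share H e \<equiv> hweight H e / (real (card e) - 1)"

lemma clique_weight_eq_sum:
  "clique_weight H u v = (\<Sum>e\<in>hedges H. edge_share H e * of_bool (u \<noteq> v \<and> u \<in> e \<and> v \<in> e))"
proof (cases "u = v")
  case False
  have "(\<Sum>e\<in>hedges H. edge_share H e * of_bool (u \<noteq> v \<and> u \<in> e \<and> v \<in> e))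
      = (\<Sum>e\<in>hedges H. if {u, v} \<subseteq> e then edge_share H e else 0)"
    using False by (intro sum.cong) auto
  also have "\<dots> = clique_weight H u v"
    using False by (simp add: clique_weight_def adjacency_matrix_def flip: sum.inter_filter)
  finally show ?thesis by simp
qed (simp add: clique_weight_def adjacency_matrix_def)

text \<open>A vertex of a hyperedge \<open>e\<close> has \<open>card e - 1\<close> neighbours in the clique on \<open>e\<close>, each joined to it with weight
\<open>w(e) / (card e - 1)\<close>.\<close>

lemma clique_weight_row_sum:
  assumes "is_hypergraph H"
  shows "(\<Sum>v\<in>UNIV. clique_weight H u v) = degree_h H u"
proof -
  have "(\<Sum>v\<in>UNIV. clique_weight H u v)
      = (\<Sum>e\<in>hedges H. edge_share H e * (\<Sum>v\<in>UNIV. of_bool (u \<noteq> v \<and> u \<in> e \<and> v \<in> e)))"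
    unfolding clique_weight_eq_sum by (subst sum.swap) (simp add: sum_distrib_left del: sum_of_bool_eq)
  also have "\<dots> = (\<Sum>e\<in>hedges H. if u \<in> e then hweight H e else 0)"
  proof (intro sum.cong refl)
    fix e assume e: "e \<in> hedges H"
    then have c: "2 \<le> card e" using assms by (simp add: is_hypergraph_def)
    have "(\<Sum>v\<in>UNIV. of_bool (u \<noteq> v \<and> u \<in> e \<and> v \<in> e)) = (if u \<in> e then real (card (e - {u})) else 0)"
      by (auto intro!: arg_cong[where f = card] simp del: card_Diff_insert card_Diff_singleton)
    then show "edge_share H e * (\<Sum>v\<in>UNIV. of_bool (u \<noteq> v \<and> u \<in> e \<and> v \<in> e)) = (if u \<in> e then hweight H e else 0)"
      using c by (simp add: card_Diff_singleton of_nat_diff del: sum_of_bool_eq)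
  qed
  also have "\<dots> = degree_h H u"
    by (simp add: degree_h_def flip: sum.inter_filter)
  finally show ?thesis .
qed

lemma hypergraph_nontrivial:
  assumes "is_hypergraph (H :: 'v::finite hypergraph)"
  shows "2 \<le> CARD('v)" "hedges H \<noteq> {}" "2 \<le> rank_h H"
proof -
  have "0 < degree_h H undefined" using assms by (simp add: is_hypergraph_def)
  then show ne: "hedges H \<noteq> {}" by (auto simp: degree_h_def)
  then obtain e where e: "e \<in> hedges H" by blast
  then have "2 \<le> card e" using assms by (simp add: is_hypergraph_def)
  moreover have "card e \<le> CARD('v)" by (intro card_mono) auto
  moreover have "card e \<le> rank_h H" using e by (simp add: rank_h_def)
  ultimately show "2 \<le> CARD('v)" "2 \<le> rank_h H" by linarith+
qed

lemma clique_graph: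
  assumes "is_hypergraph H"
  shows "weighted_graph (clique_weight H)"
proof
  show "clique_weight H u v = clique_weight H v u" for u v
    by (auto simp: clique_weight_eq_sum intro!: sum.cong)
  show "0 \<le> clique_weight H u v" for u v
    using assms by (auto simp: clique_weight_eq_sum is_hypergraph_def intro!: sum_nonneg divide_nonneg_nonneg)
  show "0 < (\<Sum>v\<in>UNIV. clique_weight H u v)" for u
    using assms by (simp add: clique_weight_row_sum is_hypergraph_def)
  show "2 \<le> CARD('a)" using hypergraph_nontrivial[OF assms] by simp
qed

lemma degree_clique_graph:
  "is_hypergraph H \<Longrightarrow> weighted_graph.deg (clique_weight H) = degree_h H"
  by (simp add: fun_eq_iff weighted_graph.deg_def[OF clique_graph] clique_weight_row_sum)

lemma vol_clique_graph:
  "is_hypergraph H \<Longrightarrow> weighted_graph.vol (clique_weight H) = vol_h H"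
  by (simp add: fun_eq_iff weighted_graph.vol_def[OF clique_graph] vol_h_def degree_clique_graph)

lemma diagonal_matrix_mult_left: "(diagonal_matrix f ** A) $ i $ j = f i * A $ i $ j"
  by (simp add: matrix_matrix_mult_def diagonal_matrix_def if_distrib[of "\<lambda>x. x * _"] cong: if_cong)

lemma diagonal_matrix_mult_right: "(A ** diagonal_matrix f) $ i $ j = A $ i $ j * f j"
  by (simp add: matrix_matrix_mult_def diagonal_matrix_def if_distrib[of "(*) _"] cong: if_cong)

lemma lambda2_clique_graph:
  assumes "is_hypergraph H"
  shows "weighted_graph.lambda2 (clique_weight H) = nu H 2"
proof -
  have "weighted_graph.norm_lap (clique_weight H) = normalized_laplacian H"
    by (simp add: vec_eq_iff weighted_graph.norm_lap_def[OF clique_graph[OF assms]]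
        degree_clique_graph[OF assms] normalized_laplacian_def diagonal_matrix_mult_left
        diagonal_matrix_mult_right laplacian_def clique_weight_def)
      (simp add: diagonal_matrix_def)
  then show ?thesis
    by (simp add: weighted_graph.lambda2_def[OF clique_graph[OF assms]] nu_def)
qed

text \<open>The clique on \<open>e\<close> has one edge across \<open>S\<close> for every pair from \<open>e \<inter> S\<close> and \<open>e \<inter> - S\<close>.\<close>

lemma cut_clique_graph:
  assumes "is_hypergraph H"
  shows "weighted_graph.cut (clique_weight H) S
    = (\<Sum>e\<in>hedges H. edge_share H e * (real (card (e \<inter> S)) * real (card (e \<inter> - S))))"
proof -
  have "weighted_graph.cut (clique_weight H) S
      = (\<Sum>u\<in>S. \<Sum>v\<in>-S. \<Sum>e\<in>hedges H. edge_share H e * (of_bool (u \<in> e) * of_bool (v \<in> e)))"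
    unfolding weighted_graph.cut_def[OF clique_graph[OF assms]] clique_weight_eq_sum
    by (intro sum.cong) auto
  also have "\<dots> = (\<Sum>e\<in>hedges H. \<Sum>u\<in>S. \<Sum>v\<in>-S. edge_share H e * (of_bool (u \<in> e) * of_bool (v \<in> e)))"
    by (subst sum.swap[of _ "hedges H"]) (subst sum.swap[of _ "hedges H"], rule refl)
  also have "\<dots> = (\<Sum>e\<in>hedges H. edge_share H e * ((\<Sum>u\<in>S. of_bool (u \<in> e)) * (\<Sum>v\<in>-S. of_bool (v \<in> e))))"
    by (simp only: sum_distrib_left[symmetric] sum_product)
  finally show ?thesis by (simp add: Int_commute)
qed

text \<open>With \<open>p, q\<close> the sizes of the two parts of \<open>e\<close>, the lower bound is \<open>(p - 1) (q - 1) \<ge> 0\<close>, and the upper bound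
\<open>2 p q \<le> (p + q) (p + q - 1)\<close> amounts to \<open>p + q \<le> p\<^sup>2 + q\<^sup>2\<close>; both need \<open>p, q \<ge> 1\<close>, that is, a split hyperedge. A
hyperedge that is not split contributes zero everywhere.\<close>

lemma edge_cut_bounds:
  fixes S :: "'v::finite set"
  assumes "is_hypergraph H" "e \<in> hedges H"
  defines "c \<equiv> edge_share H e * (real (card (e \<inter> S)) * real (card (e \<inter> - S)))"
  shows "(if e \<in> boundary_h H S then hweight H e else 0) \<le> c"
    and "2 * c \<le> real (rank_h H) * (if e \<in> boundary_h H S then hweight H e else 0)"
proof -
  define p q where "p = real (card (e \<inter> S))" and "q = real (card (e \<inter> - S))"
  have "card e = card (e \<inter> S) + card (e \<inter> - S)"
    by (subst card_Un_disjoint[symmetric]) (auto intro!: arg_cong[where f = card])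
  then have pq: "real (card e) = p + q" by (simp add: p_def q_def)
  have w: "0 \<le> hweight H e" and "2 \<le> card e" using assms by (auto simp: is_hypergraph_def)
  then have k: "2 \<le> p + q" using pq by linarith
  have r: "p + q \<le> real (rank_h H)"
    using assms(2) unfolding pq[symmetric] by (simp add: rank_h_def)
  have c: "c = hweight H e * (p * q / (p + q - 1))"
    by (simp add: c_def pq flip: p_def q_def)
  have "(if e \<in> boundary_h H S then hweight H e else 0) \<le> c \<and>
    2 * c \<le> real (rank_h H) * (if e \<in> boundary_h H S then hweight H e else 0)"
  proof (cases "e \<in> boundary_h H S")
    case True
    then have "e \<inter> S \<noteq> {}" "e \<inter> - S \<noteq> {}" by (auto simp: boundary_h_def)
    then have "1 \<le> card (e \<inter> S)" "1 \<le> card (e \<inter> - S)" by (simp_all add: Suc_le_eq card_gt_0_iff)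
    then have 1: "1 \<le> p" "1 \<le> q" by (simp_all add: p_def q_def)
    then have "0 \<le> (p - 1) * (q - 1)" by simp
    then have "1 \<le> p * q / (p + q - 1)" using k by (simp add: field_simps)
    then have "hweight H e * 1 \<le> c" unfolding c by (intro mult_left_mono w)
    then have "hweight H e \<le> c" by simp
    have "p * 1 \<le> p * p" "q * 1 \<le> q * q" using 1 by (intro mult_left_mono; simp)+
    then have "2 * (p * q / (p + q - 1)) \<le> p + q" using k by (simp add: field_simps)
    then have "hweight H e * (2 * (p * q / (p + q - 1))) \<le> hweight H e * real (rank_h H)"
      using r w by (intro mult_left_mono) auto
    moreover have "2 * c = hweight H e * (2 * (p * q / (p + q - 1)))" by (simp add: c)
    ultimately have "2 * c \<le> real (rank_h H) * hweight H e" by (simp only: mult.commute)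
    then show ?thesis using True \<open>hweight H e \<le> c\<close> by simp
  next
    case False
    then have "e \<inter> S = {} \<or> e \<inter> - S = {}" using assms(2) by (auto simp: boundary_h_def)
    then have "c = 0" by (auto simp: c_def)
    then show ?thesis using False by simp
  qed
  then show "(if e \<in> boundary_h H S then hweight H e else 0) \<le> c"
    and "2 * c \<le> real (rank_h H) * (if e \<in> boundary_h H S then hweight H e else 0)" by auto
qed

lemma hyperedge_cut_bounds:
  assumes "is_hypergraph H"
  shows "sum (hweight H) (boundary_h H S) \<le> weighted_graph.cut (clique_weight H) S"
    and "2 * weighted_graph.cut (clique_weight H) S \<le> real (rank_h H) * sum (hweight H) (boundary_h H S)"
proof -
  have *: "sum (hweight H) (boundary_h H S) = (\<Sum>e\<in>hedges H. if e \<in> boundary_h H S then hweight H e else 0)"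
    by (subst sum.inter_filter[symmetric]) (auto simp: boundary_h_def intro!: sum.cong)
  show "sum (hweight H) (boundary_h H S) \<le> weighted_graph.cut (clique_weight H) S"
    unfolding * cut_clique_graph[OF assms] by (intro sum_mono edge_cut_bounds(1) assms)
  show "2 * weighted_graph.cut (clique_weight H) S \<le> real (rank_h H) * sum (hweight H) (boundary_h H S)"
    unfolding * cut_clique_graph[OF assms] sum_distrib_left
    by (intro sum_mono edge_cut_bounds(2)[OF assms, unfolded mult.assoc])
qed

section \<open>Cheeger's inequality for hypergraphs\<close>

theorem theorem4p1:
  fixes H :: "'v::finite hypergraph"
  assumes "is_hypergraph H"
    and "connected_h H"
  shows "nu H 2 / real (rank_h H) \<le> conductance H \<and> conductance H \<le> sqrt (2 * nu H 2)"
proof -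
  note H = assms(1)
  interpret G: weighted_graph "clique_weight H" by (rule clique_graph[OF H])
  note tr = vol_clique_graph[OF H] lambda2_clique_graph[OF H]
  define W where "W S = sum (hweight H) (boundary_h H S)" for S
  have W: "W S \<le> G.cut S" "2 * G.cut S \<le> real (rank_h H) * W S" "0 \<le> W S" for S
    using hyperedge_cut_bounds[OF H, of S] H
    by (auto simp: W_def is_hypergraph_def boundary_h_def intro!: sum_nonneg)
  have sc: "set_conductance H S = W S / min (G.vol S) (G.vol (- S))" for S
    by (simp add: set_conductance_def W_def tr Compl_eq_Diff_UNIV)
  have "rank_h H > 0" using hypergraph_nontrivial[OF H] by simp
  let ?C = "{S :: 'v set. {} \<subset> S \<and> S \<subset> UNIV}"
  have "is_singleton (UNIV :: 'v set) \<Longrightarrow> False"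
    using hypergraph_nontrivial(1)[OF H] by (simp add: is_singleton_altdef)
  then have "{undefined} \<in> ?C" by (auto simp: is_singleton_def)
  then have ne: "?C \<noteq> {}" by blast
  have lower: "nu H 2 / real (rank_h H) \<le> set_conductance H S" if "S \<in> ?C" for S
  proof -
    define s t where "s = G.vol S" and "t = G.vol (- S)"
    have st: "0 < s" "0 < t" using that by (auto simp: s_def t_def intro!: G.vol_pos)
    then have m: "0 < min s t" "0 < max s t" by auto
    \<comment> \<open>Since \<open>s * t = min s t * max s t\<close> and \<open>s + t \<le> 2 * max s t\<close>, the factor \<open>max s t\<close> cancels.\<close>
    have "nu H 2 * (s * t) \<le> G.cut S * (s + t)"
      using G.cheeger_easy[of S] G.vol_Compl[of S] by (simp add: tr(2) s_def t_def)
    also have "\<dots> \<le> G.cut S * (2 * max s t)"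
      using W[of S] by (intro mult_left_mono) auto
    also have "\<dots> = 2 * G.cut S * max s t" by simp
    also have "\<dots> \<le> real (rank_h H) * W S * max s t"
      using W(2)[of S] m by (intro mult_right_mono) auto
    also have "s * t = min s t * max s t" by (simp add: min_def max_def)
    finally have "nu H 2 * min s t \<le> real (rank_h H) * W S"
      using m(2) by (simp flip: mult.assoc)
    then show ?thesis
      using m(1) \<open>rank_h H > 0\<close> unfolding sc s_def[symmetric] t_def[symmetric]
      by (simp add: pos_divide_le_eq pos_le_divide_eq mult.commute)
  qed
  have "0 \<le> set_conductance H S" if "S \<in> ?C" for S
  proof -
    have "S \<noteq> {}" "- S \<noteq> {}" using that by auto
    then have "0 < min (G.vol S) (G.vol (- S))" using G.vol_pos by simp
    then show ?thesis unfolding sc using W(3)[of S] by simp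
  qed
  then have nonneg: "0 \<le> conductance H"
    unfolding conductance_def using ne by (subst Min_ge_iff) auto
  have "(conductance H)\<^sup>2 \<le> 2 * nu H 2"
    unfolding tr(2)[symmetric]
  proof (rule G.cheeger_hard[OF _ nonneg])
    fix S assume S: "S \<noteq> {}" "G.vol S \<le> G.vol (- S)"
    have "0 < G.vol S" using S by (intro G.vol_pos)
    \<comment> \<open>A set with at most half of the volume is proper, because its complement has positive volume.\<close>
    then have "S \<noteq> UNIV" using S(2) by (auto simp: G.vol_def)
    then have "conductance H \<le> set_conductance H S"
      unfolding conductance_def using S by (intro Min_le) auto
    also have "\<dots> = W S / G.vol S" unfolding sc using S(2) by simp
    finally have "conductance H * G.vol S \<le> W S"
      using \<open>0 < G.vol S\<close> by (simp add: pos_le_divide_eq)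
    then show "conductance H * G.vol S \<le> G.cut S" using W(1)[of S] by linarith
  qed
  then have "conductance H \<le> sqrt (2 * nu H 2)" by (rule real_le_rsqrt)
  moreover have "nu H 2 / real (rank_h H) \<le> conductance H"
    unfolding conductance_def using ne lower by (subst Min_ge_iff) auto
  ultimately show ?thesis by blast
qed

end
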